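(* Let $G_1$ be an $r_1$-regular graph with $r_1\ge1$ on $n_1$ vertices and $m_1$ edges, and let $G_2$ be an $r_2$-regular graph with $r_2\ge1$ on $n_2$ vertices. Let $0=\mu_1,\mu_2,\ldots,\mu_{n_1}$ and $0=\nu_1,\nu_2,\ldots,\nu_{n_2}$ be the normalized Laplacian eigenvalues of $G_1$ and $G_2$, respectively. Then the numbers of spanning trees satisfy $$t(G_1\dot{\vee}G_2)=2^{m_1-n_1+1}\prod_{i=2}^{n_1}(2n_2+r_1\mu_i)\prod_{j=2}^{n_2}(n_1+r_2\nu_j)$$ and $$t(G_1\veebar G_2)=r_1^{\,n_1}(2+n_2)^{m_1-n_1}\prod_{i=2}^{n_1}(n_2+\mu_i)\prod_{j=2}^{n_2}(m_1+r_2\nu_j).$$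
   Context: All graphs are finite and simple; $t(G)$ denotes the number of spanning trees of $G$. For a graph $G$ without isolated vertices, with adjacency matrix $A(G)$ and diagonal degree matrix $D(G)$, the normalized Laplacian matrix is $\mathcal{L}(G)=I-D(G)^{-1/2}A(G)D(G)^{-1/2}$, and its eigenvalues are its normalized Laplacian eigenvalues. The subdivision graph $S(G)$ of $G$ is obtained by inserting a new vertex into every edge of $G$; the set of these new vertices is denoted $I(G)$. The subdivision-vertex join $G_1\dot{\vee}G_2$ is the graph obtained from $S(G_1)$ and a disjoint copy of $G_2$ by joining each vertex of $V(G_1)$ with every vertex of $V(G_2)$. The subdivision-edge join $G_1\veebar G_2$ is the graph obtained from $S(G_1)$ and a disjoint copy of $G_2$ by joining each vertex of $I(G_1)$ with every vertex of $V(G_2)$. *)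

theory Defs
  imports "HOL-Analysis.Analysis"
begin

text \<open>A finite simple graph is given by a vertex set V and an edge set E of
  2-element subsets of V.\<close>

definition simple_graph :: "'v set \<Rightarrow> 'v set set \<Rightarrow> bool" where
  "simple_graph V E \<longleftrightarrow> finite V \<and> (\<forall>e\<in>E. e \<subseteq> V \<and> card e = 2)"

definition degree :: "'v set set \<Rightarrow> 'v \<Rightarrow> nat" where
  "degree E v = card {e\<in>E. v \<in> e}"

definition regular :: "'v set \<Rightarrow> 'v set set \<Rightarrow> nat \<Rightarrow> bool" where
  "regular V E r \<longleftrightarrow> (\<forall>v\<in>V. degree E v = r)"

text \<open>Connectivity of (V,T) and cycles.\<close>

definition connected_graph :: "'v set \<Rightarrow> 'v set set \<Rightarrow> bool" where
  "connected_graph V T \<longleftrightarrow>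
     (\<forall>u\<in>V. \<forall>v\<in>V. (u, v) \<in> {(x, y). {x, y} \<in> T}\<^sup>*)"

definition has_cycle :: "'v set set \<Rightarrow> bool" where
  "has_cycle T \<longleftrightarrow> (\<exists>vs. length vs \<ge> 3 \<and> distinct vs \<and>
      (\<forall>i < length vs. {vs ! i, vs ! ((i + 1) mod length vs)} \<in> T))"

definition spanning_tree :: "'v set \<Rightarrow> 'v set set \<Rightarrow> 'v set set \<Rightarrow> bool" where
  "spanning_tree V E T \<longleftrightarrow> T \<subseteq> E \<and> connected_graph V T \<and> \<not> has_cycle T"

text \<open>Number of spanning trees t(G).\<close>
definition num_spanning_trees :: "'v set \<Rightarrow> 'v set set \<Rightarrow> nat" where
  "num_spanning_trees V E = card {T. spanning_tree V E T}"

text \<open>Normalized Laplacian of a graph whose vertex set is the whole finite type 'n.\<close>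
definition adj_matrix :: "('n::finite) set set \<Rightarrow> real^'n^'n" where
  "adj_matrix E = (\<chi> i j. if {i, j} \<in> E then 1 else 0)"

definition norm_laplacian :: "('n::finite) set set \<Rightarrow> real^'n^'n" where
  "norm_laplacian E = (\<chi> i j. (if i = j then 1 else 0)
        - adj_matrix E $ i $ j / sqrt (real (degree E i) * real (degree E j)))"

text \<open>Subdivision graph S(G1): vertices Inl v (v in V1) and Inr e (e in E1, the set I(G1)).\<close>
definition subdiv_V :: "'a set \<Rightarrow> 'a set set \<Rightarrow> ('a + 'a set) set" where
  "subdiv_V V1 E1 = Inl ` V1 \<union> Inr ` E1"

definition subdiv_E :: "'a set set \<Rightarrow> ('a + 'a set) set set" where
  "subdiv_E E1 = {{Inl v, Inr e} | v e. e \<in> E1 \<and> v \<in> e}"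

text \<open>Subdivision-vertex join of G1 and G2.\<close>
definition svjoin_V :: "'a set \<Rightarrow> 'a set set \<Rightarrow> 'b set \<Rightarrow> (('a + 'a set) + 'b) set" where
  "svjoin_V V1 E1 V2 = Inl ` subdiv_V V1 E1 \<union> Inr ` V2"

definition svjoin_E :: "'a set \<Rightarrow> 'a set set \<Rightarrow> 'b set \<Rightarrow> 'b set set
     \<Rightarrow> (('a + 'a set) + 'b) set set" where
  "svjoin_E V1 E1 V2 E2 = (`) Inl ` subdiv_E E1 \<union> (`) Inr ` E2
     \<union> {{Inl (Inl v), Inr w} | v w. v \<in> V1 \<and> w \<in> V2}"

text \<open>Subdivision-edge join of G1 and G2.\<close>
definition sejoin_E :: "'a set set \<Rightarrow> 'b set \<Rightarrow> 'b set set
     \<Rightarrow> (('a + 'a set) + 'b) set set" where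
  "sejoin_E E1 V2 E2 = (`) Inl ` subdiv_E E1 \<union> (`) Inr ` E2
     \<union> {{Inl (Inr e), Inr w} | e w. e \<in> E1 \<and> w \<in> V2}"

end

theory Submission
  imports Defs
begin

text \<open>
  Expanding the determinant of a grounded Laplacian by multilinearity in its rows gives a sum over
  functions that send every vertex other than the root to a neighbour; such a function contributes 1 if
  all of its orbits reach the root and 0 otherwise, and the contributing functions are the parent
  functions of the spanning trees. Since the Laplacian L annihilates the all-ones vector, it follows
  that det (L + u v^T) is the number of spanning trees times the sums of the entries of u and v.
  Taking u = v to be the indicator of the two completely joined vertex sets makes the matrix of either
  join block diagonal with respect to S(G1) and G2. The subdivision vertices are then removed by
  a Schur complement, and the all-ones perturbations that remain by the matrix determinant lemma.
\<close>

section \<open>Block matrices and rank-one perturbations\<close>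

lemma sum_UNIV_Plus:
  fixes f :: "'a::finite + 'b::finite \<Rightarrow> 'c::comm_monoid_add"
  shows "sum f UNIV = (\<Sum>a\<in>UNIV. f (Inl a)) + (\<Sum>b\<in>UNIV. f (Inr b))"
  by (simp add: UNIV_Plus_UNIV[symmetric] sum.Plus del: UNIV_Plus_UNIV)

text \<open>In the Leibniz expansion a permutation that moves an index outside the range of
  \<open>g\<close> meets a zero of that unit row. The surviving permutations are those of the range,
  and transport along \<open>g\<close> preserves their signs.\<close>

lemma det_unit_rows_off_range:
  fixes A :: "'c::comm_ring_1^'n^'n" and g :: "'m::finite \<Rightarrow> 'n"
  assumes g: "inj g" and A: "\<And>i j. i \<notin> range g \<Longrightarrow> A$i$j = (if i = j then 1 else 0)"
  shows "det A = det (\<chi> i j. A $ g i $ g j)"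
proof -
  let ?t = "\<lambda>p. of_int (sign p) * (\<Prod>i\<in>UNIV. A$i$p i)"
  have bij: "bij_betw g UNIV (range g)"
    using g by (simp add: bij_betw_def)
  have "det A = sum ?t {p. p permutes range g}"
    unfolding det_def
  proof (rule sum.mono_neutral_right)
    show "\<forall>p\<in>{p. p permutes UNIV} - {p. p permutes range g}. ?t p = 0"
    proof
      fix p assume p: "p \<in> {p. p permutes (UNIV :: 'n set)} - {p. p permutes range g}"
      then obtain i where i: "i \<notin> range g" "p i \<noteq> i"
        by (metis CollectD DiffE UNIV_I mem_Collect_eq permutes_superset)
      then have "A$i$p i = 0"
        using A by metis
      then have "(\<Prod>i\<in>UNIV. A$i$p i) = 0"
        by (metis UNIV_I finite prod_zero)
      then show "?t p = 0" by simp
    qed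
  qed (auto intro: permutes_subset finite_permutations)
  also have "\<dots> = (\<Sum>p\<in>{p. p permutes UNIV}. ?t (map_permutation UNIV g p))"
  proof (rule sum.reindex_bij_witness[where j = "map_permutation (range g) (inv g)" and i = "map_permutation UNIV g"])
    fix p assume p: "p \<in> {p. p permutes range g}"
    show "map_permutation UNIV g (map_permutation (range g) (inv g) p) = p"
      by (rule map_permutation_compose_inv[OF bij_betw_inv_into[OF bij]]) (use p in \<open>auto simp: f_inv_into_f\<close>)
    then show "?t (map_permutation UNIV g (map_permutation (range g) (inv g) p)) = ?t p" by simp
    show "map_permutation (range g) (inv g) p \<in> {p. p permutes UNIV}"
      using p map_permutation_permutes[OF bij_betw_inv_into[OF bij]] by simp
  next
    fix p assume p: "p \<in> {p. p permutes (UNIV :: 'm set)}"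
    show "map_permutation (range g) (inv g) (map_permutation UNIV g p) = p"
      by (rule map_permutation_compose_inv[OF bij]) (use p g in auto)
    show "map_permutation UNIV g p \<in> {p. p permutes range g}"
      using p map_permutation_permutes[OF bij] by simp
  qed
  also have "\<dots> = det (\<chi> i j. A $ g i $ g j)"
    unfolding det_def
  proof (rule sum.cong[OF refl])
    fix p assume "p \<in> {p. p permutes (UNIV :: 'm set)}"
    then have p: "p permutes UNIV" by simp
    let ?q = "map_permutation UNIV g p"
    have q: "?q permutes range g"
      using p map_permutation_permutes[OF bij] by simp
    have "(\<Prod>i\<in>UNIV. A$i$?q i) = (\<Prod>i\<in>range g. A$i$?q i)"
      by (rule prod.mono_neutral_right) (auto simp: A permutes_not_in[OF q])
    also have "\<dots> = (\<Prod>i\<in>UNIV. A $ g i $ g (p i))"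
      using g by (simp add: prod.reindex map_permutation_apply)
    finally show "?t ?q = of_int (sign p) * (\<Prod>i\<in>UNIV. (\<chi> i j. A $ g i $ g j) $ i $ p i)"
      using g p by (simp add: sign_map_permutation)
  qed
  finally show ?thesis .
qed

text \<open>Indexing by a sum type fits \<open>vec\<close>, whose dimensions are types, and matches
  the nested sum that carries the vertices of the joins.\<close>

definition block_matrix ::
    "'c^'m^'m \<Rightarrow> 'c^'n^'m \<Rightarrow> 'c^'m^'n \<Rightarrow> 'c^'n^'n \<Rightarrow> 'c^('m + 'n)^('m + 'n)" where
  "block_matrix A B C D = (\<chi> i j. case i of
      Inl a \<Rightarrow> (case j of Inl a' \<Rightarrow> A$a$a' | Inr b' \<Rightarrow> B$a$b')
    | Inr b \<Rightarrow> (case j of Inl a' \<Rightarrow> C$b$a' | Inr b' \<Rightarrow> D$b$b'))"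

lemma block_matrix_nth [simp]:
  "block_matrix A B C D $ Inl a $ Inl a' = A$a$a'"
  "block_matrix A B C D $ Inl a $ Inr b' = B$a$b'"
  "block_matrix A B C D $ Inr b $ Inl a' = C$b$a'"
  "block_matrix A B C D $ Inr b $ Inr b' = D$b$b'"
  by (simp_all add: block_matrix_def)

lemma sum_matrix_eqI:
  fixes M N :: "'c^('m + 'n)^('m::finite + 'n::finite)"
  assumes "\<And>a a'. M $ Inl a $ Inl a' = N $ Inl a $ Inl a'"
    and "\<And>a b. M $ Inl a $ Inr b = N $ Inl a $ Inr b"
    and "\<And>b a. M $ Inr b $ Inl a = N $ Inr b $ Inl a"
    and "\<And>b b'. M $ Inr b $ Inr b' = N $ Inr b $ Inr b'"
  shows "M = N"
  using assms unfolding vec_eq_iff by (metis sumE)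

lemma block_matrix_mult:
  fixes A :: "'c::semiring_1^'m::finite^'m" and D :: "'c^'n::finite^'n"
  shows "block_matrix A B C D ** block_matrix A' B' C' D' =
    block_matrix (A ** A' + B ** C') (A ** B' + B ** D') (C ** A' + D ** C') (C ** B' + D ** D')"
  by (rule sum_matrix_eqI) (simp_all add: matrix_matrix_mult_def sum_UNIV_Plus)

lemma matrix_mult_zero [simp]:
  fixes A :: "'c::semiring_1^'n::finite^'m::finite"
  shows "A ** (0 :: 'c^'k::finite^'n) = 0" "(0 :: 'c^'m^'k::finite) ** A = 0"
  by (simp_all add: matrix_matrix_mult_def vec_eq_iff)

lemma matrix_mult_uminus_right:
  fixes A :: "'c::ring_1^'n::finite^'m::finite" and B :: "'c^'k::finite^'n"
  shows "A ** (- B) = - (A ** B)"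
  by (simp add: matrix_matrix_mult_def vec_eq_iff sum_negf)

lemma det_block_unit:
  fixes A :: "'c::comm_ring_1^'m::finite^'m" and D :: "'c^'n::finite^'n"
    and B :: "'c^'n^'m" and C :: "'c^'m^'n"
  shows "det (block_matrix A B 0 (mat 1)) = det A" "det (block_matrix (mat 1) 0 C D) = det D"
proof -
  show "det (block_matrix A B 0 (mat 1)) = det A"
  proof (subst det_unit_rows_off_range[of Inl])
    fix i j :: "'m + 'n" assume "i \<notin> range Inl"
    then show "block_matrix A B 0 (mat 1) $ i $ j = (if i = j then 1 else 0)"
      by (cases i; cases j) (auto simp: mat_def)
  qed (simp_all add: vec_lambda_eta)
  show "det (block_matrix (mat 1) 0 C D) = det D"
  proof (subst det_unit_rows_off_range[of Inr])
    fix i j :: "'m + 'n" assume "i \<notin> range Inr"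
    then show "block_matrix (mat 1) 0 C D $ i $ j = (if i = j then 1 else 0)"
      by (cases i; cases j) (auto simp: mat_def)
  qed (simp_all add: vec_lambda_eta)
qed

text \<open>The matrix factors into one that contains only \<open>D\<close> and one that contains
  only \<open>A\<close> and \<open>B\<close>; \<open>det_block_unit\<close> discards the unit rows
  of each.\<close>

lemma det_block_upper_triangular:
  fixes A :: "'c::comm_ring_1^'m::finite^'m" and D :: "'c^'n::finite^'n"
  shows "det (block_matrix A B 0 D) = det A * det D"
proof -
  have "block_matrix A B 0 D = block_matrix (mat 1) 0 0 D ** block_matrix A B 0 (mat 1)"
    by (simp add: block_matrix_mult)
  then show ?thesis
    by (simp add: det_mul det_block_unit)
qed

lemma det_block_lower_triangular:
  fixes A :: "'c::comm_ring_1^'m::finite^'m" and D :: "'c^'n::finite^'n"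
  shows "det (block_matrix A 0 C D) = det A * det D"
proof -
  have "block_matrix A 0 C D = block_matrix A 0 0 (mat 1) ** block_matrix (mat 1) 0 C D"
    by (simp add: block_matrix_mult)
  then show ?thesis
    by (simp add: det_mul det_block_unit)
qed

text \<open>Right multiplication by a unitriangular matrix clears the lower left block. Giving
  \<open>X\<close> as a solution of \<open>D ** X = C\<close> keeps matrix inverses out of the
  argument.\<close>

lemma det_schur_lower:
  fixes A :: "real^'m::finite^'m" and D :: "real^'n::finite^'n"
  assumes "D ** X = C"
  shows "det (block_matrix A B C D) = det (A - B ** X) * det D"
proof -
  have "block_matrix A B C D ** block_matrix (mat 1) 0 (- X) (mat 1) = block_matrix (A - B ** X) B 0 D"
    by (simp add: block_matrix_mult assms[symmetric] matrix_mult_uminus_right)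
  then have "det (block_matrix A B C D) * det (block_matrix (mat 1) 0 (- X) (mat 1 :: real^'n^'n)) =
      det (A - B ** X) * det D"
    by (metis det_mul det_block_upper_triangular)
  then show ?thesis
    by (simp add: det_block_unit)
qed

lemma det_schur_upper:
  fixes A :: "real^'m::finite^'m" and D :: "real^'n::finite^'n"
  assumes "A ** X = B"
  shows "det (block_matrix A B C D) = det A * det (D - C ** X)"
proof -
  have "block_matrix A B C D ** block_matrix (mat 1) (- X) 0 (mat 1) = block_matrix A 0 C (D - C ** X)"
    by (simp add: block_matrix_mult assms[symmetric] matrix_mult_uminus_right)
  then have "det (block_matrix A B C D) * det (block_matrix (mat 1) (- X) 0 (mat 1 :: real^'n^'n)) =
      det A * det (D - C ** X)"
    by (metis det_mul det_block_lower_triangular)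
  then show ?thesis
    by (simp add: det_block_unit)
qed

section \<open>Rank-one perturbations of determinants\<close>

definition outer :: "real^'m \<Rightarrow> real^'n \<Rightarrow> real^'n^'m" where
  "outer u v = (\<chi> i j. u$i * v$j)"

lemma outer_nth [simp]: "outer u v $ i $ j = u$i * v$j"
  by (simp add: outer_def)

text \<open>Both Schur complements of the bordered matrix with blocks 1, -u, v, 1 compute its determinant.\<close>

lemma det_one_plus_outer:
  fixes u v :: "real^'n::finite"
  shows "det (mat 1 + outer u v) = 1 + u \<bullet> v"
proof -
  let ?M = "block_matrix (mat 1) (\<chi> i j. - u$i) (\<chi> i j. v$j) (mat 1) :: real^('n + 1)^('n + 1)"
  have "det ?M = det (mat 1 + outer u v)"
    by (subst det_schur_lower[OF matrix_mul_lid])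
      (simp add: arg_cong[where f = det] vec_eq_iff matrix_matrix_mult_def outer_def)
  moreover have "det ?M = 1 + u \<bullet> v"
    by (subst det_schur_upper[OF matrix_mul_lid])
      (simp add: det_1 matrix_matrix_mult_def inner_vec_def sum_negf mult.commute,
        simp add: mat_def)
  ultimately show ?thesis by simp
qed

text \<open>The matrix determinant lemma with a preimage of \<open>u\<close> in place of an inverse:
  \<open>A\<close> maps \<open>x /\<^sub>R c\<close> to \<open>u\<close>, so \<open>A\<close>
  factors out of the sum on the left.\<close>

lemma det_add_outer:
  fixes A :: "real^'n::finite^'n"
  assumes "A *v x = c *\<^sub>R u" "c \<noteq> 0"
  shows "det (A + outer u v) = det A * (1 + (x \<bullet> v) / c)"
proof -
  have "A ** outer (x /\<^sub>R c) v = outer u v"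
  proof -
    have "(A *v x) $ i = c * u$i" for i
      using assms by simp
    then have "(\<Sum>k\<in>UNIV. A$i$k * x$k) = c * u$i" for i
      by (simp add: matrix_vector_mult_def)
    then show ?thesis
      using assms(2)
      by (simp add: vec_eq_iff matrix_matrix_mult_def sum_divide_distrib[symmetric]
          sum_distrib_right[symmetric] mult.assoc[symmetric] divide_inverse_commute)
        (simp add: mult.assoc mult.left_commute[of _ "inverse c"] sum_distrib_left[symmetric])
  qed
  then have "A + outer u v = A ** (mat 1 + outer (x /\<^sub>R c) v)"
    by (simp add: matrix_add_ldistrib)
  then show ?thesis
    by (simp add: det_mul det_one_plus_outer divide_inverse_commute)
qed

section \<open>The matrix-tree theorem\<close>

text \<open>Fixing \<open>f\<close> at the root and outside \<open>V\<close> lets a tree determine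
  the total function. The last clause excludes cycles of \<open>f\<close>, so that all edges are
  oriented towards \<open>r\<close>.\<close>

definition parent_function :: "'v set \<Rightarrow> 'v set set \<Rightarrow> 'v \<Rightarrow> ('v \<Rightarrow> 'v) \<Rightarrow> bool" where
  "parent_function V E r f \<longleftrightarrow> (\<forall>i\<in>V - {r}. {i, f i} \<in> E) \<and> (\<forall>i. i \<notin> V - {r} \<longrightarrow> f i = i) \<and>
     (\<forall>i\<in>V. \<exists>k. (f ^^ k) i = r)"

definition parent_edges :: "'v set \<Rightarrow> 'v \<Rightarrow> ('v \<Rightarrow> 'v) \<Rightarrow> 'v set set" where
  "parent_edges V r f = (\<lambda>i. {i, f i}) ` (V - {r})"

definition depth :: "'v \<Rightarrow> ('v \<Rightarrow> 'v) \<Rightarrow> 'v \<Rightarrow> nat" where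
  "depth r f i = (LEAST k. (f ^^ k) i = r)"

lemma edge_rel_sym: "sym {(x, y). {x, y} \<in> T}"
  by (auto simp: sym_def insert_commute)

lemma simple_graph_edgeD:
  assumes "simple_graph V E" "{i, j} \<in> E"
  shows "i \<in> V" "j \<in> V" "i \<noteq> j"
  using assms by (auto simp: simple_graph_def)

lemma parent_in:
  assumes "simple_graph V E" "parent_function V E r f" "i \<in> V"
  shows "f i \<in> V"
  using assms simple_graph_edgeD unfolding parent_function_def by (metis Diff_iff)

text \<open>The iterates from \<open>i\<close> are those from \<open>f i\<close> delayed by one
  step, as \<open>i\<close> is not the root itself. This strict descent drives the inductions and
  the acyclicity argument.\<close>

lemma depth_parent:
  assumes G: "simple_graph V E" and f: "parent_function V E r f" and i: "i \<in> V" "i \<noteq> r"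
  shows "depth r f i = Suc (depth r f (f i))"
proof -
  have ex: "\<exists>k. (f ^^ k) j = r" if "j \<in> V" for j
    using f that by (simp add: parent_function_def)
  have i0: "(f ^^ depth r f i) i = r" and fi0: "(f ^^ depth r f (f i)) (f i) = r"
    using LeastI_ex[OF ex] i parent_in[OF G f] unfolding depth_def by blast+
  from i0 i obtain k where k: "depth r f i = Suc k" "(f ^^ k) (f i) = r"
    by (cases "depth r f i") (auto simp: funpow_swap1)
  have "depth r f (f i) \<le> k"
    using k(2) unfolding depth_def by (rule Least_le)
  moreover have "depth r f i \<le> Suc (depth r f (f i))"
    unfolding depth_def[of r f i] by (rule Least_le) (use fi0 in \<open>simp add: funpow_swap1\<close>)
  ultimately show ?thesis using k by simp
qed

lemma parent_edges_connected:
  assumes G: "simple_graph V E" and f: "parent_function V E r f"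
  shows "connected_graph V (parent_edges V r f)"
proof -
  let ?R = "{(x, y). {x, y} \<in> parent_edges V r f}"
  have root: "i \<in> V \<Longrightarrow> (i, r) \<in> ?R\<^sup>*" for i
  proof (induction "depth r f i" arbitrary: i rule: less_induct)
    case less
    show ?case
    proof (cases "i = r")
      case False
      then have "(f i, r) \<in> ?R\<^sup>*"
        using less depth_parent[OF G f] parent_in[OF G f] by simp
      moreover have "(i, f i) \<in> ?R"
        using False less.prems by (auto simp: parent_edges_def)
      ultimately show ?thesis by (rule converse_rtrancl_into_rtrancl[rotated])
    qed simp
  qed
  have "sym (?R\<^sup>*)"
    by (intro sym_rtrancl edge_rel_sym)
  then show ?thesis
    unfolding connected_graph_def using root by (meson rtrancl_trans symD)
qed

text \<open>A vertex of maximal depth on a cycle would have both its neighbours equal to its parent.\<close>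

lemma parent_edges_acyclic:
  assumes G: "simple_graph V E" and f: "parent_function V E r f"
  shows "\<not> has_cycle (parent_edges V r f)"
proof
  assume "has_cycle (parent_edges V r f)"
  then obtain vs where vs: "length vs \<ge> 3" "distinct vs"
    and edge: "\<And>i. i < length vs \<Longrightarrow> {vs ! i, vs ! ((i + 1) mod length vs)} \<in> parent_edges V r f"
    unfolding has_cycle_def by blast
  let ?n = "length vs"
  let ?d = "depth r f"
  have parent: "u = f v" if uv: "{v, u} \<in> parent_edges V r f" "?d u \<le> ?d v" for u v
  proof -
    obtain i where i: "i \<in> V" "i \<noteq> r" "{v, u} = {i, f i}"
      using uv(1) unfolding parent_edges_def by blast
    then show ?thesis
      using depth_parent[OF G f i(1,2)] uv(2) by (auto simp: doubleton_eq_iff)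
  qed
  have "finite (set vs)" "set vs \<noteq> {}" using vs by auto
  then have "Max (?d ` set vs) \<in> ?d ` set vs" by simp
  then obtain v where v: "v \<in> set vs" "?d v = Max (?d ` set vs)" by auto
  have max: "?d u \<le> ?d v" if "u \<in> set vs" for u
    unfolding v(2) using that by simp
  from v(1) obtain i where i: "i < ?n" "v = vs ! i"
    by (auto simp: in_set_conv_nth)
  \<comment> \<open>The cyclic predecessor of \<open>i\<close>, with the wrap-around at 0 made
    explicit.\<close>
  define j where "j = (if i = 0 then ?n - 1 else i - 1)"
  have j: "j < ?n" "(j + 1) mod ?n = i"
    using i vs by (auto simp: j_def)
  have k: "(i + 1) mod ?n < ?n"
    by (rule mod_less_divisor) (use vs in linarith)
  have "vs ! ((i + 1) mod ?n) = f v"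
    using parent[OF _ max[OF nth_mem[OF k]]] edge[OF i(1)] i by simp
  moreover have "vs ! j = f v"
    using parent[OF _ max[OF nth_mem[OF j(1)]]] edge[OF j(1)] i j by (simp add: insert_commute)
  ultimately have "(i + 1) mod ?n = j"
    using nth_eq_iff_index_eq[OF vs(2) k j(1)] by simp
  \<comment> \<open>Predecessor and successor coincide, which is impossible on a cycle of at least
    three vertices.\<close>
  then show False
    using vs i by (auto simp: j_def mod_Suc split: if_splits)
qed

lemma parent_edges_spanning_tree:
  assumes "simple_graph V E" "parent_function V E r f"
  shows "spanning_tree V E (parent_edges V r f)"
  using parent_edges_connected[OF assms] parent_edges_acyclic[OF assms] assms(2)
  unfolding spanning_tree_def parent_edges_def parent_function_def by blast

text \<open>Induction on the depth in \<open>g\<close>: the edge \<open>{i, g i}\<close> is also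
  \<open>{j, f j}\<close> for some \<open>j\<close>. If \<open>j = g i\<close>, then
  \<open>f (g i) = i\<close>, and the induction hypothesis turns this into
  \<open>g (g i) = i\<close>, against the depths in \<open>g\<close>. So
  \<open>j = i\<close>.\<close>

lemma parent_edges_inj:
  assumes G: "simple_graph V E" and f: "parent_function V E r f" and g: "parent_function V E r g"
    and eq: "parent_edges V r f = parent_edges V r g"
  shows "f = g"
proof
  fix i
  have "f i = g i" if "i \<in> V"
    using that
  proof (induction "depth r g i" arbitrary: i rule: less_induct)
    case less
    show ?case
    proof (cases "i = r")
      case True
      then show ?thesis using f g by (simp add: parent_function_def)
    next
      case False
      have IH: "f (g i) = g (g i)"
        using less False depth_parent[OF G g] parent_in[OF G g] by simp
      have gg: "g (g i) \<noteq> i"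
      proof
        assume *: "g (g i) = i"
        have "g i \<noteq> r"
          using * False g by (metis DiffE insertI1 parent_function_def)
        then have "depth r g (g i) = Suc (depth r g i)"
          using depth_parent[OF G g, of "g i"] parent_in[OF G g] less.prems * by simp
        then show False
          using depth_parent[OF G g less.prems False] by simp
      qed
      have "{i, g i} \<in> parent_edges V r f"
        using less.prems False unfolding eq by (auto simp: parent_edges_def)
      then show ?thesis
        using IH gg by (auto simp: parent_edges_def doubleton_eq_iff)
    qed
  qed
  then show "f i = g i"
    using f g by (cases "i \<in> V") (simp_all add: parent_function_def)
qed

section \<open>Paths, cycles and the orientation of a spanning tree towards its root\<close>

lemma rtrancl_simple_path:
  assumes "(u, v) \<in> R\<^sup>*"
  shows "\<exists>vs. vs \<noteq> [] \<and> distinct vs \<and> hd vs = u \<and> last vs = v \<and>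
    (\<forall>i. Suc i < length vs \<longrightarrow> (vs ! i, vs ! Suc i) \<in> R)"
  using assms
proof (induction rule: converse_rtrancl_induct)
  case base
  show ?case by (rule exI[of _ "[v]"]) simp
next
  case (step u w)
  then obtain vs where vs: "vs \<noteq> []" "distinct vs" "hd vs = w" "last vs = v"
    "\<And>i. Suc i < length vs \<Longrightarrow> (vs ! i, vs ! Suc i) \<in> R"
    by blast
  show ?case
  proof (cases "u \<in> set vs")
    \<comment> \<open>The path already visits \<open>u\<close>; its tail from there on starts at
      \<open>u\<close> and stays simple.\<close>
    case True
    then obtain k where "k < length vs" "vs ! k = u"
      by (auto simp: in_set_conv_nth)
    then show ?thesis
      using vs by (intro exI[of _ "drop k vs"]) (auto simp: hd_drop_conv_nth)
  next
    case False
    then show ?thesis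
      using vs step.hyps(1)
      by (intro exI[of _ "u # vs"]) (auto simp: nth_Cons hd_conv_nth split: nat.split)
  qed
qed

text \<open>A simple path between the ends of a missing edge has at least three vertices: one vertex
  would give \<open>u = v\<close>, two would put the edge into \<open>T\<close>. The new edge then
  serves the wrap-around index of the cycle.\<close>

lemma has_cycle_closing_edge:
  assumes path: "(u, v) \<in> {(x, y). {x, y} \<in> T}\<^sup>*" and uv: "u \<noteq> v" "{u, v} \<notin> T"
  shows "has_cycle (insert {u, v} T)"
proof -
  obtain vs where vs: "vs \<noteq> []" "distinct vs" "hd vs = u" "last vs = v"
    and step: "\<And>i. Suc i < length vs \<Longrightarrow> {vs ! i, vs ! Suc i} \<in> T"
    using rtrancl_simple_path[OF path] by auto
  have "length vs \<noteq> 1"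
    using vs uv by (auto simp: length_Suc_conv)
  moreover have "length vs \<noteq> 2"
    using vs uv step[of 0] by (auto simp: hd_conv_nth last_conv_nth)
  ultimately have len: "length vs \<ge> 3"
    using vs(1) by (metis One_nat_def Suc_1 Suc_leI le_neq_implies_less length_greater_0_conv numeral_3_eq_3)
  have "{vs ! i, vs ! ((i + 1) mod length vs)} \<in> insert {u, v} T" if "i < length vs" for i
  proof (cases "Suc i < length vs")
    case True
    then show ?thesis using step by simp
  next
    case False
    then have "i = length vs - 1" "(i + 1) mod length vs = 0"
      using that by (auto simp: mod_Suc)
    then show ?thesis
      using vs by (simp add: hd_conv_nth last_conv_nth insert_commute)
  qed
  then show ?thesis
    using len vs(2) unfolding has_cycle_def by blast
qed

lemma has_cycle_mono: "has_cycle S \<Longrightarrow> S \<subseteq> T \<Longrightarrow> has_cycle T"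
  unfolding has_cycle_def by (meson subsetD)

text \<open>Sending each vertex to a neighbour in \<open>T\<close> closer to \<open>r\<close>
  orients the tree. The parent edges already connect \<open>V\<close>, so any further edge of
  \<open>T\<close> would close a cycle.\<close>

lemma spanning_tree_parent_function:
  assumes G: "simple_graph V E" and r: "r \<in> V" and T: "spanning_tree V E T"
  shows "\<exists>f. parent_function V E r f \<and> parent_edges V r f = T"
proof -
  let ?R = "{(x, y). {x, y} \<in> T}"
  define dist where "dist v = (LEAST k. (v, r) \<in> ?R ^^ k)" for v
  have TE: "T \<subseteq> E" and conn: "connected_graph V T" and acyc: "\<not> has_cycle T"
    using T by (auto simp: spanning_tree_def)
  have closer: "\<exists>u. {v, u} \<in> T \<and> dist u < dist v" if v: "v \<in> V - {r}" for v
  proof -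
    have "(v, r) \<in> ?R\<^sup>*"
      using conn v r by (auto simp: connected_graph_def)
    then have "\<exists>k. (v, r) \<in> ?R ^^ k"
      by (simp add: rtrancl_power)
    then have dv: "(v, r) \<in> ?R ^^ dist v"
      unfolding dist_def by (rule LeastI_ex)
    with v obtain k where k: "dist v = Suc k"
      by (cases "dist v") auto
    with dv obtain u where u: "(v, u) \<in> ?R" "(u, r) \<in> ?R ^^ k"
      by (metis relpow_Suc_E2)
    then have "dist u \<le> k"
      unfolding dist_def by (intro Least_le)
    with u k show ?thesis by auto
  qed
  \<comment> \<open>Any closer neighbour will do; outside \<open>V - {r}\<close> the value is the
    one that \<open>parent_function\<close> prescribes.\<close>
  define f where "f v = (if v \<in> V - {r} then SOME u. {v, u} \<in> T \<and> dist u < dist v else v)" for v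
  have f: "{v, f v} \<in> T" "dist (f v) < dist v" if "v \<in> V - {r}" for v
    using someI_ex[OF closer[OF that]] that by (auto simp: f_def)
  have "v \<in> V \<Longrightarrow> \<exists>k. (f ^^ k) v = r" for v
  proof (induction "dist v" arbitrary: v rule: less_induct)
    case less
    show ?case
    proof (cases "v = r")
      case True
      then have "(f ^^ 0) v = r" by simp
      then show ?thesis ..
    next
      case False
      then have "f v \<in> V"
        using f(1) less.prems TE simple_graph_edgeD(2)[OF G] by blast
      then obtain k where "(f ^^ k) (f v) = r"
        using less f(2) False by blast
      then have "(f ^^ Suc k) v = r" by (simp add: funpow_swap1)
      then show ?thesis ..
    qed
  qed
  then have pf: "parent_function V E r f"
    using f(1) TE by (auto simp: parent_function_def f_def)
  have sub: "parent_edges V r f \<subseteq> T"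
    using f(1) by (auto simp: parent_edges_def)
  have "T \<subseteq> parent_edges V r f"
  proof (rule ccontr)
    assume "\<not> ?thesis"
    then obtain e where e: "e \<in> T" "e \<notin> parent_edges V r f" by blast
    with TE G have "card e = 2" by (auto simp: simple_graph_def)
    then obtain u v where uv: "e = {u, v}" "u \<noteq> v"
      by (auto simp: card_2_iff)
    have "u \<in> V" "v \<in> V"
      using simple_graph_edgeD[OF G] e TE uv by blast+
    then have "(u, v) \<in> {(x, y). {x, y} \<in> parent_edges V r f}\<^sup>*"
      using parent_edges_connected[OF G pf] by (simp add: connected_graph_def)
    then have "has_cycle (insert e (parent_edges V r f))"
      using has_cycle_closing_edge uv e by metis
    then show False
      using has_cycle_mono acyc sub e by (metis insert_subset)
  qed
  with sub pf show ?thesis by blast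
qed

lemma num_spanning_trees_eq_parent_functions:
  assumes "simple_graph V E" "r \<in> V"
  shows "num_spanning_trees V E = card {f. parent_function V E r f}"
proof -
  have "bij_betw (parent_edges V r) {f. parent_function V E r f} {T. spanning_tree V E T}"
    unfolding bij_betw_def
  proof
    show "inj_on (parent_edges V r) {f. parent_function V E r f}"
      using parent_edges_inj[OF assms(1)] by (auto intro: inj_onI)
    show "parent_edges V r ` {f. parent_function V E r f} = {T. spanning_tree V E T}"
      using parent_edges_spanning_tree[OF assms(1)] spanning_tree_parent_function[OF assms]
      by (auto simp: image_iff) metis
  qed
  then show ?thesis
    unfolding num_spanning_trees_def by (simp add: bij_betw_same_card)
qed

section \<open>Determinants of grounded Laplacians\<close>

lemma det_eq_0_if_kernel:
  fixes A :: "real^'n^'n"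
  assumes "A *v x = 0" "x \<noteq> 0"
  shows "det A = 0"
  using assms
  by (metis invertible_det_nz invertible_left_inverse matrix_left_invertible_ker)

text \<open>The term that a choice \<open>f\<close> of neighbours contributes to the row expansion
  of the grounded Laplacian.\<close>

definition parent_matrix :: "'v::finite set \<Rightarrow> 'v \<Rightarrow> ('v \<Rightarrow> 'v) \<Rightarrow> real^'v^'v" where
  "parent_matrix V r f = (\<chi> i. if i \<in> V - {r} then axis i 1 - axis (f i) 1 else axis i 1)"

text \<open>If all orbits reach \<open>r\<close>, only the identity permutation contributes;
  otherwise the indicator of the vertices that never reach \<open>r\<close> is a nonzero kernel
  vector.\<close>

lemma det_parent_matrix:
  fixes f :: "'v::finite \<Rightarrow> 'v"
  assumes G: "simple_graph V E" and loc: "\<And>i. i \<in> V - {r} \<Longrightarrow> {i, f i} \<in> E"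
  shows "det (parent_matrix V r f) = (if \<forall>i\<in>V. \<exists>k. (f ^^ k) i = r then 1 else 0)"
proof (cases "\<forall>i\<in>V. \<exists>k. (f ^^ k) i = r")
  case True
  let ?M = "parent_matrix V r f"
  have "det ?M = (\<Sum>p\<in>{id}. of_int (sign p) * (\<Prod>i\<in>UNIV. ?M$i$p i))"
    unfolding det_def
  proof (rule sum.mono_neutral_right)
    show "\<forall>p\<in>{p. p permutes UNIV} - {id}. of_int (sign p) * (\<Prod>i\<in>UNIV. ?M$i$p i) = 0"
    proof
      fix p assume p: "p \<in> {p. p permutes (UNIV :: 'v set)} - {id}"
      have "\<exists>i. ?M$i$p i = 0"
      proof (rule ccontr)
        assume "\<not> ?thesis"
        then have nz: "\<And>i. ?M$i$p i \<noteq> 0" by blast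
        have moved: "i \<in> V - {r} \<and> p i = f i" if "p i \<noteq> i" for i
          using nz[of i] that by (auto simp: parent_matrix_def axis_def split: if_splits)
        have "inj p" using p permutes_inj by blast
        from p obtain i where i: "p i \<noteq> i" by (auto simp: fun_eq_iff)
        \<comment> \<open>A contributing permutation moves a point only to its parent. By
          injectivity it then moves the parent too, hence the whole orbit up to the root, whose unit
          row forbids this.\<close>
        have "p ((f ^^ k) i) \<noteq> (f ^^ k) i" for k
        proof (induction k)
          case (Suc k)
          then show ?case
            using moved[OF Suc] \<open>inj p\<close> by (metis funpow.simps(2) comp_apply injD)
        qed (simp add: i)
        moreover obtain k where "(f ^^ k) i = r"
          using True moved[OF i] by blast
        ultimately have "p r \<noteq> r" by metis
        then show False using moved by blast
      qed
      then have "(\<Prod>i\<in>UNIV. ?M$i$p i) = 0" by (simp add: prod_zero_iff)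
      then show "of_int (sign p) * (\<Prod>i\<in>UNIV. ?M$i$p i) = 0" by simp
    qed
  qed (simp_all add: permutes_id finite_permutations)
  also have "\<dots> = (\<Prod>i\<in>UNIV. ?M$i$i)" by simp
  \<comment> \<open>An edge \<open>{i, f i}\<close> is no loop, so the parent entry stays off the
    diagonal.\<close>
  also have "\<dots> = 1"
  proof (rule prod.neutral, rule ballI)
    fix i
    show "?M$i$i = 1"
      using simple_graph_edgeD(3)[OF G loc, of i] by (auto simp: parent_matrix_def axis_def)
  qed
  finally show ?thesis using True by simp
next
  case False
  define x :: "real^'v" where "x = (\<chi> i. if i \<in> V \<and> (\<nexists>k. (f ^^ k) i = r) then 1 else 0)"
  have xr: "x $ r = 0"
    unfolding x_def by (simp, metis funpow_0)
  have step: "(\<exists>k. (f ^^ k) (f i) = r) \<longleftrightarrow> (\<exists>k. (f ^^ k) i = r)" if "i \<noteq> r" for i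
  proof
    assume "\<exists>k. (f ^^ k) i = r"
    then obtain k where "(f ^^ k) i = r" ..
    then show "\<exists>k. (f ^^ k) (f i) = r"
      using that by (cases k) (auto simp: funpow_swap1)
  next
    assume "\<exists>k. (f ^^ k) (f i) = r"
    then show "\<exists>k. (f ^^ k) i = r"
      by (metis funpow_swap1 funpow.simps(2) comp_apply)
  qed
  have xf: "x $ f i = x $ i" if "i \<in> V - {r}" for i
    using that simple_graph_edgeD(2)[OF G loc[OF that]] step[of i] by (auto simp: x_def)
  have "(parent_matrix V r f *v x) $ i = 0" for i
  proof -
    have ax: "(\<Sum>j\<in>UNIV. axis k 1 $ j * x $ j) = x $ k" for k
      by (simp add: axis_def if_distrib[where f = "\<lambda>c. c * _"] cong: if_cong)
    show ?thesis
      using xf[of i] xr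
      by (auto simp: matrix_vector_mult_def parent_matrix_def ax left_diff_distrib sum_subtractf)
        (auto simp: x_def)
  qed
  then have "parent_matrix V r f *v x = 0" by (simp add: vec_eq_iff)
  moreover have "x \<noteq> 0"
    using False by (auto simp: x_def vec_eq_iff)
  ultimately have "det (parent_matrix V r f) = 0"
    by (rule det_eq_0_if_kernel)
  then show ?thesis using False by simp
qed

text \<open>Indices outside the vertex set get a unit row, so that they do not influence determinants.\<close>

definition laplacian :: "'v::finite set \<Rightarrow> 'v set set \<Rightarrow> real^'v^'v" where
  "laplacian V E = (\<chi> i j. (if i = j then (\<Sum>k\<in>UNIV. adj_matrix E $ i $ k) + (if i \<in> V then 0 else 1) else 0)
     - adj_matrix E $ i $ j)"

lemma det_grounded_laplacian:
  fixes V :: "'v::finite set"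
  assumes G: "simple_graph V E" and r: "r \<in> V"
  shows "det (\<chi> i. if i = r then axis r 1 else laplacian V E $ i) = num_spanning_trees V E"
proof -
  \<comment> \<open>The terms whose sum over \<open>j\<close> is row \<open>i\<close> of the
    grounded Laplacian: one per neighbour at a nonroot vertex, the single term \<open>j = i\<close>
    in a unit row. Choosing one \<open>j\<close> in every row gives a function.\<close>
  define a :: "'v \<Rightarrow> 'v \<Rightarrow> real^'v" where
    "a i j = (if i \<in> V - {r} then adj_matrix E $ i $ j *\<^sub>R (axis i 1 - axis j 1)
       else if j = i then axis i 1 else 0)" for i j
  let ?loc = "\<lambda>f. (\<forall>i\<in>V - {r}. {i, f i} \<in> E) \<and> (\<forall>i. i \<notin> V - {r} \<longrightarrow> f i = i)"
  have "(\<chi> i. if i = r then axis r 1 else laplacian V E $ i) = (\<chi> i. \<Sum>j\<in>UNIV. a i j)"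
  proof -
    have "(if i = r then axis r 1 else laplacian V E $ i) $ k = (\<Sum>j\<in>UNIV. a i j) $ k" for i k
    proof (cases "i \<in> V - {r}")
      case True
      have "(\<Sum>j\<in>UNIV. a i j) $ k =
          (\<Sum>j\<in>UNIV. adj_matrix E $ i $ j * (if k = i then 1 else 0)) -
          (\<Sum>j\<in>UNIV. adj_matrix E $ i $ j * (if k = j then 1 else 0))"
        using True by (auto simp: a_def sum_component axis_def right_diff_distrib sum_subtractf)
      then show ?thesis
        using True
        by (auto simp: laplacian_def if_distrib[where f = "\<lambda>c. _ * c"] cong: if_cong)
    next
      case False
      then have "a i j = (if j = i then axis i 1 else 0)" for j
        by (auto simp: a_def)
      then have "(\<Sum>j\<in>UNIV. a i j) = axis i 1" by simp
      moreover have "adj_matrix E $ i $ j = 0" if "i \<notin> V" for j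
        using that simple_graph_edgeD(1)[OF G, of i j] by (auto simp: adj_matrix_def)
      ultimately show ?thesis
        using False by (auto simp: laplacian_def axis_def)
    qed
    then show ?thesis by (simp add: vec_eq_iff)
  qed
  then have "det (\<chi> i. if i = r then axis r 1 else laplacian V E $ i) = (\<Sum>f\<in>UNIV. det (\<chi> i. a i (f i)))"
    by (simp add: det_linear_rows_sum)
  also have "\<dots> = (\<Sum>f\<in>UNIV. if parent_function V E r f then 1 else 0)"
  proof (rule sum.cong[OF refl])
    fix f
    show "det (\<chi> i. a i (f i)) = (if parent_function V E r f then 1 else 0)"
    proof (cases "?loc f")
      case True
      then have "(\<chi> i. a i (f i)) = parent_matrix V r f"
        by (simp add: vec_eq_iff a_def parent_matrix_def adj_matrix_def)
      then show ?thesis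
        using True det_parent_matrix[OF G, of r f] by (simp add: parent_function_def)
    next
      case False
      \<comment> \<open>A choice that is not along an edge, or that moves an index of a unit row,
        produces a zero row.\<close>
      then obtain i where "i \<in> V - {r} \<and> {i, f i} \<notin> E \<or> i \<notin> V - {r} \<and> f i \<noteq> i"
        by blast
      then have "a i (f i) = 0"
        by (auto simp: a_def adj_matrix_def)
      then have "det (\<chi> i. a i (f i)) = 0"
        by (intro det_zero_row(1)[of i]) (simp add: row_def vec_eq_iff)
      then show ?thesis
        using False by (auto simp: parent_function_def)
    qed
  qed
  also have "\<dots> = num_spanning_trees V E"
    by (simp add: num_spanning_trees_eq_parent_functions[OF G r] sum.If_cases)
  finally show ?thesis .
qed

definition indicator_vec :: "'v::finite set \<Rightarrow> real^'v" where
  "indicator_vec S = (\<chi> i. if i \<in> S then 1 else 0)"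

abbreviation ones_matrix :: "real^'v::finite^'v" where
  "ones_matrix \<equiv> outer (indicator_vec UNIV) (indicator_vec UNIV)"

text \<open>Rows of vertices sum to zero over \<open>V\<close>, and a unit row outside
  \<open>V\<close> meets a zero entry of the indicator.\<close>

lemma laplacian_indicator:
  assumes "simple_graph V E"
  shows "laplacian V E *v indicator_vec V = 0"
proof -
  have "(laplacian V E *v indicator_vec V) $ i = 0" for i
  proof -
    have "adj_matrix E $ i $ j * indicator_vec V $ j = adj_matrix E $ i $ j" for j
      using simple_graph_edgeD(2)[OF assms, of i j] by (auto simp: adj_matrix_def indicator_vec_def)
    then have "(\<Sum>j\<in>UNIV. adj_matrix E $ i $ j * indicator_vec V $ j) = (\<Sum>j\<in>UNIV. adj_matrix E $ i $ j)"
      by (rule sum.cong[OF refl])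
    moreover have "adj_matrix E $ i $ j = 0" if "i \<notin> V" for j
      using that simple_graph_edgeD(1)[OF assms, of i j] by (auto simp: adj_matrix_def)
    moreover have "(if i \<in> V then 0 else 1) * indicator_vec V $ i = 0"
      by (simp add: indicator_vec_def)
    ultimately show ?thesis
      by (cases "i \<in> V") (simp_all add: matrix_vector_mult_def laplacian_def left_diff_distrib sum_subtractf
          if_distrib[where f = "\<lambda>c. c * _"] indicator_vec_def cong: if_cong)
  qed
  then show ?thesis by (simp add: vec_eq_iff)
qed

lemma laplacian_transpose: "transpose (laplacian V E) = laplacian V E"
  by (auto simp: vec_eq_iff transpose_def laplacian_def adj_matrix_def insert_commute)

lemma outer_mult_vec: "outer u v *v x = (v \<bullet> x) *\<^sub>R u"
  by (simp add: vec_eq_iff matrix_vector_mult_def inner_vec_def sum_distrib_left mult_ac)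

text \<open>The grounded Laplacian maps the indicator of V to the basis vector of the root; hence each
  of the two factors of the rank-one term can be installed by the matrix determinant lemma.\<close>

theorem matrix_tree:
  fixes V :: "'v::finite set"
  assumes G: "simple_graph V E" and V: "V \<noteq> {}"
  shows "det (laplacian V E + outer u v) =
    num_spanning_trees V E * (indicator_vec V \<bullet> u) * (indicator_vec V \<bullet> v)"
proof -
  obtain r where r: "r \<in> V" using V by blast
  let ?L = "laplacian V E" and ?one = "indicator_vec V" and ?e = "axis r 1 :: real^'v"
  let ?K = "\<chi> i. if i = r then ?e else ?L $ i"
  have one_e: "?one \<bullet> ?e = 1"
    using r by (simp add: inner_axis indicator_vec_def)
  have L1: "(\<Sum>j\<in>UNIV. ?L $ i $ j * ?one $ j) = 0" for i
    using arg_cong[OF laplacian_indicator[OF G], of "\<lambda>x. x $ i"] by (simp add: matrix_vector_mult_def)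
  have "(?K *v ?one) $ i = ?e $ i" for i
    using L1[of i] r by (auto simp: matrix_vector_mult_def axis_def indicator_vec_def
        if_distrib[where f = "\<lambda>c. c * _"] cong: if_cong)
  then have K1: "?K *v ?one = 1 *\<^sub>R ?e" by (simp add: vec_eq_iff)
  \<comment> \<open>Row \<open>r\<close> of \<open>?K\<close> is \<open>?e\<close>, so a single
    rank-one update both restores the row \<open>?L $ r\<close> and adds \<open>u\<close> to
    it.\<close>
  have KL: "?L + outer ?e u = ?K + outer ?e (?L $ r + u - ?e)"
    by (auto simp: vec_eq_iff axis_def)
  have "?one \<bullet> ?L $ r = 0"
    using L1[of r] by (simp add: inner_vec_def mult.commute)
  then have detu: "det (?L + outer ?e u) = num_spanning_trees V E * (?one \<bullet> u)"
    unfolding KL by (subst det_add_outer[OF K1])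
      (simp_all add: det_grounded_laplacian[OF G r] inner_add_right inner_diff_right one_e)
  \<comment> \<open>Symmetry of the Laplacian moves \<open>u\<close> to the column side and frees
    the row side for \<open>v\<close>.\<close>
  have tr: "transpose (?L + outer ?e u) = ?L + outer u ?e"
    using laplacian_transpose[of V E] by (simp add: vec_eq_iff transpose_def)
  have "(?L + outer u ?e) *v ?one = 1 *\<^sub>R u"
    by (simp add: matrix_vector_mult_add_rdistrib laplacian_indicator[OF G] outer_mult_vec
        inner_commute[of ?e] one_e)
  note * = det_add_outer[OF this, of "v - ?e"]
  \<comment> \<open>The second update replaces the provisional row factor \<open>?e\<close> by
    \<open>v\<close>.\<close>
  have "?L + outer u v = ?L + outer u ?e + outer u (v - ?e)"
    by (simp add: vec_eq_iff algebra_simps)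
  then have "det (?L + outer u v) = det (transpose (?L + outer ?e u)) * (?one \<bullet> v)"
    using * by (simp only: tr) (simp add: inner_diff_right one_e)
  then show ?thesis
    by (simp only: det_transpose detu)
qed

section \<open>Regular graphs\<close>

lemma indicator_vec_nth [simp]: "indicator_vec S $ i = (if i \<in> S then 1 else 0)"
  by (simp add: indicator_vec_def)

lemma mat_nth [simp]: "mat c $ i $ j = (if i = j then c else 0)"
  by (simp add: mat_def)

lemma det_scaleR: "det (c *\<^sub>R A) = c ^ CARD('n) * det A" for A :: "real^'n::finite^'n"
proof -
  have "c *\<^sub>R A = (\<chi> i. c *s A $ i)"
    by (simp add: vec_eq_iff)
  then show ?thesis
    using det_rows_mul[of "\<lambda>_. c" "\<lambda>i. A $ i"] by (simp add: vec_lambda_eta)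
qed

lemma sum_adj_matrix:
  fixes E :: "'v::finite set set"
  assumes "simple_graph UNIV E"
  shows "(\<Sum>k\<in>UNIV. adj_matrix E $ i $ k) = real (degree E i)"
proof -
  have "bij_betw (\<lambda>k. {i, k}) {k. {i, k} \<in> E} {e \<in> E. i \<in> e}"
  proof (rule bij_betwI')
    fix e assume e: "e \<in> {e \<in> E. i \<in> e}"
    then have "card e = 2" using assms by (auto simp: simple_graph_def)
    with e show "\<exists>k\<in>{k. {i, k} \<in> E}. e = {i, k}"
      by (auto simp: card_2_iff doubleton_eq_iff insert_commute)
  qed (auto simp: doubleton_eq_iff)
  then have "degree E i = card {k. {i, k} \<in> E}"
    unfolding degree_def by (simp add: bij_betw_same_card)
  then show ?thesis
    by (simp add: adj_matrix_def sum.If_cases)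
qed

text \<open>Columns are indexed by all vertex sets, since an index set has to be a type; the columns
  of nonedges vanish.\<close>

definition incidence_matrix :: "'v::finite set set \<Rightarrow> real^('v set)^'v" where
  "incidence_matrix E = (\<chi> v e. if e \<in> E \<and> v \<in> e then 1 else 0)"

lemma incidence_nonedge: "e \<notin> E \<Longrightarrow> incidence_matrix E $ v $ e = 0"
  by (simp add: incidence_matrix_def)

lemma incidence_row_sum: "(\<Sum>e\<in>UNIV. incidence_matrix E $ v $ e) = real (degree E v)"
  by (simp add: incidence_matrix_def degree_def sum.If_cases)

lemma incidence_column_sum:
  assumes "simple_graph UNIV E"
  shows "(\<Sum>v\<in>UNIV. incidence_matrix E $ v $ e) = (if e \<in> E then 2 else 0)"
proof (cases "e \<in> E")
  case True
  then have "card e = 2" using assms by (simp add: simple_graph_def)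
  then show ?thesis using True by (simp add: incidence_matrix_def sum.If_cases)
qed (simp add: incidence_matrix_def)

lemma regular_degree: "regular UNIV E r \<Longrightarrow> degree E i = r"
  by (simp add: regular_def)

context
  fixes E :: "'v::finite set set" and r :: nat
  assumes G: "simple_graph UNIV E" and reg: "regular UNIV E r" and r: "r \<ge> 1"
begin

text \<open>Equal degrees turn the square root into \<open>r\<close>, which links the normalized
  Laplacian to adjacency entries.\<close>

lemma norm_laplacian_regular: "real r *\<^sub>R norm_laplacian E = real r *\<^sub>R mat 1 - adj_matrix E"
proof -
  have "real r * norm_laplacian E $ i $ j = (if i = j then real r else 0) - adj_matrix E $ i $ j" for i j
    using r by (simp add: norm_laplacian_def regular_degree[OF reg] right_diff_distrib)
  then show ?thesis by (simp add: vec_eq_iff)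
qed

text \<open>The Gram matrix is the signless Laplacian, \<open>r\<close> times the identity plus the
  adjacency matrix. Written with the normalized Laplacian, it is what the Schur complements of both
  joins produce.\<close>

lemma incidence_gram:
  "incidence_matrix E ** transpose (incidence_matrix E) = (2 * real r) *\<^sub>R mat 1 - real r *\<^sub>R norm_laplacian E"
proof -
  have "(\<Sum>e\<in>UNIV. incidence_matrix E $ i $ e * incidence_matrix E $ j $ e) =
      (if i = j then real r else 0) + adj_matrix E $ i $ j" for i j
  proof (cases "i = j")
    case True
    have "incidence_matrix E $ i $ e * incidence_matrix E $ i $ e = incidence_matrix E $ i $ e" for e
      by (simp add: incidence_matrix_def)
    moreover have "{i} \<notin> E"
      using G by (auto simp: simple_graph_def)
    ultimately show ?thesis
      using True incidence_row_sum[of E i] by (simp only:) (simp add: regular_degree[OF reg] adj_matrix_def)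
  next
    case False
    \<comment> \<open>Two distinct vertices lie on at most one common edge, the pair itself.\<close>
    have iff: "(e \<in> E \<and> i \<in> e) \<and> e \<in> E \<and> j \<in> e \<longleftrightarrow> e = {i, j} \<and> {i, j} \<in> E" for e
    proof
      assume *: "(e \<in> E \<and> i \<in> e) \<and> e \<in> E \<and> j \<in> e"
      then have "card e = 2" using G by (simp add: simple_graph_def)
      then obtain x y where "e = {x, y}" by (auto simp: card_2_iff)
      with * False have "e = {i, j}" by auto
      with * show "e = {i, j} \<and> {i, j} \<in> E" by simp
    qed auto
    have mult_if: "(if P then 1 else 0) * (if Q then 1 else (0::real)) = (if P \<and> Q then 1 else 0)" for P Q
      by simp
    have "incidence_matrix E $ i $ e * incidence_matrix E $ j $ e =
        (if e = {i, j} then adj_matrix E $ i $ j else 0)" for e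
      by (simp only: incidence_matrix_def adj_matrix_def vec_lambda_beta mult_if iff) simp
    then show ?thesis using False by simp
  qed
  then show ?thesis
    by (simp add: norm_laplacian_regular vec_eq_iff matrix_matrix_mult_def transpose_def)
qed

lemma norm_laplacian_ones: "norm_laplacian E *v indicator_vec UNIV = 0"
proof -
  have "real r * (\<Sum>j\<in>UNIV. norm_laplacian E $ i $ j) = 0" for i
  proof -
    have "real r * norm_laplacian E $ i $ j = (if i = j then real r else 0) - adj_matrix E $ i $ j" for j
      using arg_cong[OF norm_laplacian_regular, of "\<lambda>A. A $ i $ j"] by simp
    then show ?thesis
      by (simp add: sum_distrib_left sum_subtractf sum_adj_matrix[OF G] regular_degree[OF reg])
  qed
  then show ?thesis
    using r by (simp add: vec_eq_iff matrix_vector_mult_def)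
qed

section \<open>Determinants of shifted normalized Laplacians\<close>

context
  fixes mu :: "nat \<Rightarrow> real"
  assumes mu1: "mu 1 = 0"
    and eig: "\<forall>x::real. det (x *\<^sub>R mat 1 - norm_laplacian E) = (\<Prod>i=1..CARD('v). x - mu i)"
begin

text \<open>This is the characteristic polynomial at \<open>- c / s\<close>, with each factor
  rescaled by \<open>- s\<close>; the eigenvalue \<open>mu 1 = 0\<close> yields the factor
  \<open>c\<close>.\<close>

lemma det_shift_norm_laplacian:
  assumes "s \<noteq> 0"
  shows "det (c *\<^sub>R mat 1 + s *\<^sub>R norm_laplacian E) = c * (\<Prod>i=2..CARD('v). c + s * mu i)"
proof -
  have "c *\<^sub>R mat 1 + s *\<^sub>R norm_laplacian E = (- s) *\<^sub>R ((- c / s) *\<^sub>R mat 1 - norm_laplacian E)"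
    using assms by (simp add: vec_eq_iff algebra_simps)
  then have "det (c *\<^sub>R mat 1 + s *\<^sub>R norm_laplacian E) =
      (- s) ^ CARD('v) * (\<Prod>i=1..CARD('v). - c / s - mu i)"
    using eig by (simp only: det_scaleR)
  also have "\<dots> = (\<Prod>i=1..CARD('v). - s * (- c / s - mu i))"
    by (simp only: prod.distrib prod_constant card_atLeastAtMost) simp
  also have "\<dots> = (\<Prod>i=1..CARD('v). c + s * mu i)"
    using assms by (intro prod.cong) (auto simp: field_simps)
  also have "\<dots> = c * (\<Prod>i=2..CARD('v). c + s * mu i)"
    using mu1 by (subst prod.atLeast_Suc_atMost) (auto simp: Suc_le_eq numeral_2_eq_2)
  finally show ?thesis .
qed

text \<open>The all-ones vector is an eigenvector for \<open>c\<close>, so the perturbation only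
  raises the factor \<open>c\<close> by the number of vertices.\<close>

lemma det_shift_norm_laplacian_ones:
  assumes "s \<noteq> 0" "c > 0"
  shows "det (c *\<^sub>R mat 1 + s *\<^sub>R norm_laplacian E + ones_matrix) =
    (c + real CARD('v)) * (\<Prod>i=2..CARD('v). c + s * mu i)"
proof -
  have "(c *\<^sub>R mat 1 + s *\<^sub>R norm_laplacian E) *v indicator_vec UNIV = c *\<^sub>R indicator_vec UNIV"
    by (simp add: matrix_vector_mult_add_rdistrib scaleR_matrix_vector_assoc[symmetric]
        norm_laplacian_ones)
  from det_add_outer[OF this, of "indicator_vec UNIV"] assms
  have "det (c *\<^sub>R mat 1 + s *\<^sub>R norm_laplacian E + ones_matrix) =
      c * (\<Prod>i=2..CARD('v). c + s * mu i) * (1 + real CARD('v) / c)"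
    by (simp add: det_shift_norm_laplacian inner_vec_def)
  then show ?thesis
    using assms(2) by (simp only:) (simp add: field_simps)
qed

end

end

section \<open>The subdivision joins\<close>

lemma simple_graph_subdivision_join:
  fixes E1 :: "'a::finite set set" and E2 :: "'b::finite set set"
  assumes "simple_graph UNIV E2"
  shows "simple_graph (svjoin_V UNIV E1 UNIV) (svjoin_E UNIV E1 UNIV E2)"
    and "simple_graph (svjoin_V UNIV E1 UNIV) (sejoin_E E1 UNIV E2)"
proof -
  let ?V = "svjoin_V UNIV E1 UNIV :: (('a + 'a set) + 'b) set"
  have 1: "e \<subseteq> ?V \<and> card e = 2" if "e \<in> (`) Inl ` subdiv_E E1" for e
    using that by (auto simp: svjoin_V_def subdiv_V_def subdiv_E_def)
  have 2: "e \<subseteq> ?V \<and> card e = 2" if "e \<in> (`) Inr ` E2" for e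
    using that assms by (auto simp: svjoin_V_def simple_graph_def card_image)
  have 3: "e \<subseteq> ?V \<and> card e = 2" if "e \<in> {{Inl (Inl v), Inr w} | v w. v \<in> UNIV \<and> w \<in> UNIV}" for e
    using that by (auto simp: svjoin_V_def subdiv_V_def)
  have 4: "e \<subseteq> ?V \<and> card e = 2" if "e \<in> {{Inl (Inr f), Inr w} | f w. f \<in> E1 \<and> w \<in> UNIV}" for e
    using that by (auto simp: svjoin_V_def subdiv_V_def)
  show "simple_graph ?V (svjoin_E UNIV E1 UNIV E2)" "simple_graph ?V (sejoin_E E1 UNIV E2)"
    unfolding simple_graph_def svjoin_E_def sejoin_E_def
    using 1 2 3 4 by (meson UnE finite)+
qed

lemma image_doubleton_iff:
  assumes "inj g"
  shows "{g x, g y} \<in> (`) g ` E \<longleftrightarrow> {x, y} \<in> E"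
proof -
  have "g ` {x, y} \<in> (`) g ` E \<longleftrightarrow> {x, y} \<in> E"
    by (rule inj_image_mem_iff) (simp add: inj_def inj_image_eq_iff[OF assms])
  then show ?thesis by simp
qed

lemma sum_doubleton_image:
  "{Inl x, Inl y} \<in> (`) Inl ` E \<longleftrightarrow> {x, y} \<in> E"
  "{Inr z, Inr w} \<in> (`) Inr ` F \<longleftrightarrow> {z, w} \<in> F"
  "{Inl x, Inr z} \<notin> (`) Inl ` E" "{Inl x, Inr z} \<notin> (`) Inr ` F"
  "{Inr z, Inl x} \<notin> (`) Inl ` E" "{Inr z, Inl x} \<notin> (`) Inr ` F"
  "{Inl x, Inl y} \<notin> (`) Inr ` F" "{Inr z, Inr w} \<notin> (`) Inl ` E"
proof -
  show "{Inl x, Inl y} \<in> (`) Inl ` E \<longleftrightarrow> {x, y} \<in> E" "{Inr z, Inr w} \<in> (`) Inr ` F \<longleftrightarrow> {z, w} \<in> F"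
    by (simp_all add: image_doubleton_iff)
qed auto

lemma subdiv_E_doubleton:
  "{Inl a, Inr e} \<in> subdiv_E E \<longleftrightarrow> e \<in> E \<and> a \<in> e" "{Inr e, Inl a} \<in> subdiv_E E \<longleftrightarrow> e \<in> E \<and> a \<in> e"
  "{Inl a, Inl a'} \<notin> subdiv_E E" "{Inr e, Inr e'} \<notin> subdiv_E E"
  by (auto simp: subdiv_E_def doubleton_eq_iff)

lemma svjoin_adj:
  fixes E1 :: "'a::finite set set" and E2 :: "'b::finite set set"
  defines "A \<equiv> adj_matrix (svjoin_E UNIV E1 UNIV E2)"
  shows "A $ Inl (Inl a) $ Inl (Inl a') = 0" "A $ Inl (Inl a) $ Inl (Inr e) = incidence_matrix E1 $ a $ e"
    "A $ Inl (Inl a) $ Inr w = 1" "A $ Inl (Inr e) $ Inl (Inl a) = incidence_matrix E1 $ a $ e"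
    "A $ Inl (Inr e) $ Inl (Inr e') = 0" "A $ Inl (Inr e) $ Inr w = 0"
    "A $ Inr w $ Inl (Inl a) = 1" "A $ Inr w $ Inl (Inr e) = 0"
    "A $ Inr w $ Inr w' = adj_matrix E2 $ w $ w'"
  unfolding A_def adj_matrix_def incidence_matrix_def svjoin_E_def
  by (simp_all add: sum_doubleton_image subdiv_E_doubleton doubleton_eq_iff)

text \<open>An index \<open>Inr e\<close> exists for every set \<open>e\<close>, but only edges are
  vertices of the join; hence the conditional entries.\<close>

lemma sejoin_adj:
  fixes E1 :: "'a::finite set set" and E2 :: "'b::finite set set"
  defines "A \<equiv> adj_matrix (sejoin_E E1 UNIV E2)"
  shows "A $ Inl (Inl a) $ Inl (Inl a') = 0" "A $ Inl (Inl a) $ Inl (Inr e) = incidence_matrix E1 $ a $ e"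
    "A $ Inl (Inl a) $ Inr w = 0" "A $ Inl (Inr e) $ Inl (Inl a) = incidence_matrix E1 $ a $ e"
    "A $ Inl (Inr e) $ Inl (Inr e') = 0" "A $ Inl (Inr e) $ Inr w = (if e \<in> E1 then 1 else 0)"
    "A $ Inr w $ Inl (Inl a) = 0" "A $ Inr w $ Inl (Inr e) = (if e \<in> E1 then 1 else 0)"
    "A $ Inr w $ Inr w' = adj_matrix E2 $ w $ w'"
  unfolding A_def adj_matrix_def incidence_matrix_def sejoin_E_def
  by (simp_all add: sum_doubleton_image subdiv_E_doubleton doubleton_eq_iff)

lemma join_vertex_cases:
  fixes i :: "('x + 'y) + 'z"
  obtains a where "i = Inl (Inl a)" | e where "i = Inl (Inr e)" | w where "i = Inr w"
  by (metis sumE)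

text \<open>The diagonal block of the subdivision vertices; the value 1 off \<open>S\<close>
  provides the unit rows for sets that are not edges.\<close>

definition diag_on :: "'v::finite set \<Rightarrow> real \<Rightarrow> real^'v^'v" where
  "diag_on S c = (\<chi> i j. if i = j then if i \<in> S then c else 1 else 0)"

lemma det_diag_on: "det (diag_on S c) = c ^ card S"
  by (subst det_diagonal) (simp_all add: diag_on_def prod.If_cases)

lemma diag_on_mult_nth: "(diag_on S c ** A) $ i $ j = (if i \<in> S then c else 1) * A $ i $ j"
  by (simp add: diag_on_def matrix_matrix_mult_def if_distrib[where f = "\<lambda>x. x * _"] cong: if_cong)

section \<open>Spanning tree counts of the two joins\<close>

context
  fixes E1 :: "'a::finite set set" and E2 :: "'b::finite set set"
    and r1 r2 :: nat and mu nu :: "nat \<Rightarrow> real"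
  assumes G1: "simple_graph UNIV E1" and reg1: "regular UNIV E1 r1" and r1: "r1 \<ge> 1"
    and G2: "simple_graph UNIV E2" and reg2: "regular UNIV E2 r2" and r2: "r2 \<ge> 1"
    and mu1: "mu 1 = 0"
    and mu_eig: "\<forall>x::real. det (x *\<^sub>R mat 1 - norm_laplacian E1) = (\<Prod>i=1..CARD('a). x - mu i)"
    and nu1: "nu 1 = 0"
    and nu_eig: "\<forall>x::real. det (x *\<^sub>R mat 1 - norm_laplacian E2) = (\<Prod>j=1..CARD('b). x - nu j)"
begin

lemma laplacian_G2_entry:
  "real r2 * norm_laplacian E2 $ w $ w' = (if w = w' then real r2 else 0) - adj_matrix E2 $ w $ w'"
  using arg_cong[OF norm_laplacian_regular[OF G2 reg2 r2], of "\<lambda>A. A $ w $ w'"] by simp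

text \<open>The rank-one term cancels the blocks between V1 and V2.\<close>

lemma svjoin_laplacian_blocks:
  defines "u \<equiv> indicator_vec (Inl ` Inl ` UNIV \<union> Inr ` UNIV)"
  shows "laplacian (svjoin_V UNIV E1 UNIV) (svjoin_E UNIV E1 UNIV E2) + outer u u =
    block_matrix
      (block_matrix ((real r1 + real CARD('b)) *\<^sub>R mat 1 + ones_matrix) (- incidence_matrix E1) (- transpose (incidence_matrix E1))
        (diag_on E1 2))
      0 0 (real CARD('a) *\<^sub>R mat 1 + real r2 *\<^sub>R norm_laplacian E2 + ones_matrix)" (is "_ = ?B")
proof -
  have "(laplacian (svjoin_V UNIV E1 UNIV) (svjoin_E UNIV E1 UNIV E2) + outer u u) $ i $ j = ?B $ i $ j" for i j
    \<comment> \<open>The diagonal comes from the degrees: r1 + n2 on V1, 2 on subdivision vertices,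
      n1 + r2 on V2.\<close>
    by (cases i rule: join_vertex_cases; cases j rule: join_vertex_cases)
      (auto simp: u_def laplacian_def diag_on_def svjoin_adj sum_UNIV_Plus svjoin_V_def subdiv_V_def
        laplacian_G2_entry incidence_row_sum incidence_column_sum[OF G1] sum_adj_matrix[OF G2]
        regular_degree[OF reg1] regular_degree[OF reg2] transpose_def incidence_nonedge image_iff
        sum.If_cases split: if_splits)
  then show ?thesis by (simp add: vec_eq_iff)
qed

text \<open>The matrix-tree theorem contributes the square of n1 + n2 on the left, and each of the
  two diagonal blocks contributes one factor n1 + n2 on the right, so these cancel.\<close>

lemma num_spanning_trees_svjoin:
  "real (num_spanning_trees (svjoin_V UNIV E1 UNIV) (svjoin_E UNIV E1 UNIV E2)) =
    2 powi (int (card E1) - int CARD('a) + 1)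
    * (\<Prod>i=2..CARD('a). 2 * real CARD('b) + real r1 * mu i) * (\<Prod>j=2..CARD('b). real CARD('a) + real r2 * nu j)"
proof -
  let ?t = "real (num_spanning_trees (svjoin_V UNIV E1 UNIV) (svjoin_E UNIV E1 UNIV E2))"
  let ?N = "incidence_matrix E1"
  let ?n1 = "real CARD('a)" and ?n2 = "real CARD('b)"
  let ?D = "diag_on E1 2"
  let ?P = "\<Prod>i=2..CARD('a). ?n2 + real r1 / 2 * mu i"
  let ?Q = "\<Prod>j=2..CARD('b). ?n1 + real r2 * nu j"
  let ?V = "svjoin_V UNIV E1 UNIV :: (('a + 'a set) + 'b) set"
  define u :: "real^(('a + 'a set) + 'b)" where "u = indicator_vec (Inl ` Inl ` UNIV \<union> Inr ` UNIV)"
  have "indicator_vec ?V \<bullet> u = ?n1 + ?n2"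
    by (simp add: inner_vec_def u_def svjoin_V_def subdiv_V_def sum_UNIV_Plus image_iff)
  moreover have "?V \<noteq> {}" by (auto simp: svjoin_V_def)
  ultimately have "?t * (?n1 + ?n2) * (?n1 + ?n2) =
      det (laplacian ?V (svjoin_E UNIV E1 UNIV E2) + outer u u)"
    by (simp add: matrix_tree simple_graph_subdivision_join[OF G2])
  also have "\<dots> = det (block_matrix ((real r1 + ?n2) *\<^sub>R mat 1 + ones_matrix) (- ?N) (- transpose ?N) ?D)
      * det (?n1 *\<^sub>R mat 1 + real r2 *\<^sub>R norm_laplacian E2 + ones_matrix)"
    unfolding u_def svjoin_laplacian_blocks by (rule det_block_upper_triangular)
  also have "det (?n1 *\<^sub>R mat 1 + real r2 *\<^sub>R norm_laplacian E2 + ones_matrix) = (?n1 + ?n2) * ?Q"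
    using r2 by (intro det_shift_norm_laplacian_ones[OF G2 reg2 r2 nu1 nu_eig]) auto
  \<comment> \<open>Halving the transposed incidence matrix solves the equation with
    \<open>?D\<close>, since its rows at nonedges, where \<open>?D\<close> has 1 instead of 2, are
    zero.\<close>
  also have "det (block_matrix ((real r1 + ?n2) *\<^sub>R mat 1 + ones_matrix) (- ?N) (- transpose ?N) ?D) =
      det ((real r1 + ?n2) *\<^sub>R mat 1 + ones_matrix - (- ?N) ** ((- 1 / 2) *\<^sub>R transpose ?N)) * det ?D"
    by (rule det_schur_lower)
      (auto simp: vec_eq_iff diag_on_mult_nth transpose_def incidence_nonedge)
  \<comment> \<open>Half the Gram matrix removes exactly the r1 that the edges of S(G1) add to the
    degrees.\<close>
  also have "(real r1 + ?n2) *\<^sub>R mat 1 + ones_matrix - (- ?N) ** ((- 1 / 2) *\<^sub>R transpose ?N) =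
      ?n2 *\<^sub>R mat 1 + (real r1 / 2) *\<^sub>R norm_laplacian E1 + ones_matrix"
  proof -
    have "(- ?N) ** ((- 1 / 2) *\<^sub>R transpose ?N) = (1 / 2) *\<^sub>R (?N ** transpose ?N)"
      by (simp add: vec_eq_iff matrix_matrix_mult_def sum_divide_distrib)
    then show ?thesis
      by (simp add: incidence_gram[OF G1 reg1 r1] vec_eq_iff)
  qed
  also have "det (?n2 *\<^sub>R mat 1 + (real r1 / 2) *\<^sub>R norm_laplacian E1 + ones_matrix) = (?n2 + ?n1) * ?P"
    using r1 by (intro det_shift_norm_laplacian_ones[OF G1 reg1 r1 mu1 mu_eig]) auto
  also have "det ?D = 2 ^ card E1" by (rule det_diag_on)
  finally have "?t * (?n1 + ?n2)\<^sup>2 = 2 ^ card E1 * ?P * ?Q * (?n1 + ?n2)\<^sup>2"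
    by (simp add: power2_eq_square mult_ac add.commute)
  moreover have "?n1 + ?n2 \<noteq> 0" by (simp add: add_nonneg_eq_0_iff)
  ultimately have t: "?t = 2 ^ card E1 * ?P * ?Q" by simp
  have "(\<Prod>i=2..CARD('a). 2 * ?n2 + real r1 * mu i) = (\<Prod>i=2..CARD('a). 2 * (?n2 + real r1 / 2 * mu i))"
    by (simp add: distrib_left)
  also have "\<dots> = 2 ^ (CARD('a) - 1) * ?P"
    by (simp only: prod.distrib prod_constant card_atLeastAtMost) simp
  \<comment> \<open>The n1 - 1 halves in \<open>?P\<close> lower the exponent of 2, which can become
    negative when r1 = 1; hence \<open>powi\<close>.\<close>
  also have "2 powi (int (card E1) - int CARD('a) + 1) * (2 ^ (CARD('a) - 1) * ?P) = 2 ^ card E1 * ?P"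
  proof -
    have "(2::real) powi (int (card E1) - int CARD('a) + 1) * 2 powi int (CARD('a) - 1) = 2 powi int (card E1)"
      by (subst power_int_add[symmetric]) (simp_all add: of_nat_diff Suc_le_eq)
    then show ?thesis by (simp only: power_int_of_nat mult.assoc[symmetric])
  qed
  finally show ?thesis using t by simp
qed

text \<open>Here the rank-one term cancels the blocks between I(G1) and V2.\<close>

lemma sejoin_laplacian_blocks:
  defines "u \<equiv> indicator_vec (Inl ` Inr ` E1 \<union> Inr ` UNIV)"
  shows "laplacian (svjoin_V UNIV E1 UNIV) (sejoin_E E1 UNIV E2) + outer u u =
    block_matrix
      (block_matrix (real r1 *\<^sub>R mat 1) (- incidence_matrix E1) (- transpose (incidence_matrix E1))
        (diag_on E1 (2 + real CARD('b)))
       + outer (indicator_vec (Inr ` E1)) (indicator_vec (Inr ` E1)))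
      0 0 (real (card E1) *\<^sub>R mat 1 + real r2 *\<^sub>R norm_laplacian E2 + ones_matrix)" (is "_ = ?B")
proof -
  have "(laplacian (svjoin_V UNIV E1 UNIV) (sejoin_E E1 UNIV E2) + outer u u) $ i $ j = ?B $ i $ j" for i j
    \<comment> \<open>Here the degrees are r1 on V1, 2 + n2 on subdivision vertices and m1 + r2 on
      V2.\<close>
    by (cases i rule: join_vertex_cases; cases j rule: join_vertex_cases)
      (auto simp: u_def laplacian_def diag_on_def sejoin_adj sum_UNIV_Plus svjoin_V_def subdiv_V_def
        laplacian_G2_entry incidence_row_sum incidence_column_sum[OF G1] sum_adj_matrix[OF G2]
        regular_degree[OF reg1] regular_degree[OF reg2] transpose_def incidence_nonedge image_iff
        sum.If_cases split: if_splits)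
  then show ?thesis by (simp add: vec_eq_iff)
qed

text \<open>The G2 block is shifted by the number of edges of G1, which must be positive to use
  \<open>det_shift_norm_laplacian_ones\<close>. Here \<open>undefined\<close> stands for an
  arbitrary vertex.\<close>

lemma card_edges_pos: "card E1 > 0"
proof -
  have "degree E1 undefined \<noteq> 0"
    using r1 by (simp add: regular_degree[OF reg1])
  then have "E1 \<noteq> {}" by (auto simp: degree_def)
  then show ?thesis by (simp add: card_gt_0_iff)
qed

text \<open>The all-ones term now sits on the subdivision vertices, so it is split off before the
  Schur complement, while their block is still diagonal. The square of m1 + n2 cancels in the
  end.\<close>

lemma num_spanning_trees_sejoin:
  "real (num_spanning_trees (svjoin_V UNIV E1 UNIV) (sejoin_E E1 UNIV E2)) =
    real r1 ^ CARD('a) * (2 + real CARD('b)) powi (int (card E1) - int CARD('a))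
    * (\<Prod>i=2..CARD('a). real CARD('b) + mu i) * (\<Prod>j=2..CARD('b). real (card E1) + real r2 * nu j)"
proof -
  let ?t = "real (num_spanning_trees (svjoin_V UNIV E1 UNIV) (sejoin_E E1 UNIV E2))"
  let ?N = "incidence_matrix E1" and ?m1 = "real (card E1)"
  let ?n1 = "real CARD('a)" and ?n2 = "real CARD('b)"
  let ?D = "diag_on E1 (2 + ?n2)"
  let ?M = "block_matrix (real r1 *\<^sub>R mat 1) (- ?N) (- transpose ?N) ?D"
  let ?P = "\<Prod>i=2..CARD('a). ?n2 + mu i"
  let ?Q = "\<Prod>j=2..CARD('b). ?m1 + real r2 * nu j"
  let ?V = "svjoin_V UNIV E1 UNIV :: (('a + 'a set) + 'b) set"
  \<comment> \<open>With this ratio r1 equals \<open>s * (2 + ?n2)\<close>, and the Schur complement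
    becomes a shift by \<open>s * ?n2\<close> of \<open>s\<close> times the normalized
    Laplacian.\<close>
  define s where "s = real r1 / (2 + ?n2)"
  define u :: "real^(('a + 'a set) + 'b)" where "u = indicator_vec (Inl ` Inr ` E1 \<union> Inr ` UNIV)"
  define y :: "real^('a + 'a set)" where "y = indicator_vec (Inr ` E1)"
  \<comment> \<open>All ones on the vertices of S(G1): a row of \<open>?M\<close> at V1 gives r1 -
    r1 = 0, a row at an edge gives 2 + n2 - 2, so \<open>?M\<close> sends \<open>x\<close> to
    \<open>?n2\<close> times \<open>y\<close>.\<close>
  define x :: "real^('a + 'a set)" where "x = indicator_vec (Inl ` UNIV \<union> Inr ` E1)"
  have card_sum: "(\<Sum>e\<in>UNIV. if e \<in> E1 then 1 else 0) = ?m1"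
    by (simp add: sum.If_cases)
  have n2pos: "?n2 > 0" by simp
  have "indicator_vec ?V \<bullet> u = ?m1 + ?n2"
    using card_sum
    by (simp add: inner_vec_def u_def svjoin_V_def subdiv_V_def sum_UNIV_Plus image_iff
        if_distrib[where f = "\<lambda>x. x * _"] cong: if_cong)
  moreover have "?V \<noteq> {}" by (auto simp: svjoin_V_def)
  ultimately have "?t * (?m1 + ?n2) * (?m1 + ?n2) =
      det (laplacian ?V (sejoin_E E1 UNIV E2) + outer u u)"
    by (simp add: matrix_tree simple_graph_subdivision_join[OF G2])
  also have "\<dots> = det (?M + outer y y) * det (?m1 *\<^sub>R mat 1 + real r2 *\<^sub>R norm_laplacian E2 + ones_matrix)"
    unfolding u_def y_def sejoin_laplacian_blocks by (rule det_block_upper_triangular)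
  also have "det (?m1 *\<^sub>R mat 1 + real r2 *\<^sub>R norm_laplacian E2 + ones_matrix) = (?m1 + ?n2) * ?Q"
    using r2 card_edges_pos by (intro det_shift_norm_laplacian_ones[OF G2 reg2 r2 nu1 nu_eig]) auto
  also have "det (?M + outer y y) = det ?M * (1 + (x \<bullet> y) / ?n2)"
  proof (rule det_add_outer)
    have vertex: "(?M *v x) $ Inl v = ?n2 * y $ Inl v" for v
    proof -
      have "(\<Sum>e\<in>UNIV. if e \<in> E1 then - ?N $ v $ e else 0) = (\<Sum>e\<in>UNIV. - ?N $ v $ e)"
        by (rule sum.cong) (auto simp: incidence_nonedge)
      also have "\<dots> = - real r1"
        by (simp add: sum_negf incidence_row_sum regular_degree[OF reg1])
      finally show ?thesis
        by (simp add: matrix_vector_mult_def sum_UNIV_Plus x_def y_def image_iff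
            if_distrib[where f = "\<lambda>c. _ * c"] cong: if_cong)
    qed
    have edge: "(?M *v x) $ Inr e = ?n2 * y $ Inr e" for e
      by (simp add: diag_on_def matrix_vector_mult_def sum_UNIV_Plus x_def y_def image_iff sum_negf transpose_def
          incidence_column_sum[OF G1] if_distrib[where f = "\<lambda>x. x * _"] cong: if_cong)
    show "?M *v x = ?n2 *\<^sub>R y"
      unfolding vec_eq_iff by (metis vertex edge sumE vector_scaleR_component real_scaleR_def)
  qed (use n2pos in simp)
  also have "x \<bullet> y = ?m1"
    using card_sum
    by (simp add: inner_vec_def x_def y_def sum_UNIV_Plus image_iff
        if_distrib[where f = "\<lambda>x. x * _"] cong: if_cong)
  also have "det ?M = det (real r1 *\<^sub>R mat 1 - (- ?N) ** ((- 1 / (2 + ?n2)) *\<^sub>R transpose ?N)) * det ?D"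
    by (rule det_schur_lower)
      (use n2pos in \<open>auto simp: vec_eq_iff diag_on_mult_nth transpose_def incidence_nonedge\<close>)
  also have "real r1 *\<^sub>R mat 1 - (- ?N) ** ((- 1 / (2 + ?n2)) *\<^sub>R transpose ?N) =
      (s * ?n2) *\<^sub>R mat 1 + s *\<^sub>R norm_laplacian E1"
  proof -
    have "(- ?N) ** ((- 1 / (2 + ?n2)) *\<^sub>R transpose ?N) = (1 / (2 + ?n2)) *\<^sub>R (?N ** transpose ?N)"
      by (simp add: vec_eq_iff matrix_matrix_mult_def sum_divide_distrib)
    also have "\<dots> = (2 * s) *\<^sub>R mat 1 - s *\<^sub>R norm_laplacian E1"
      by (simp add: incidence_gram[OF G1 reg1 r1] vec_eq_iff s_def diff_divide_distrib)
    finally have gram: "(- ?N) ** ((- 1 / (2 + ?n2)) *\<^sub>R transpose ?N) =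
        (2 * s) *\<^sub>R mat 1 - s *\<^sub>R norm_laplacian E1" .
    have r1_eq: "real r1 = s * (2 + ?n2)" using n2pos by (simp add: s_def)
    show ?thesis
      unfolding gram r1_eq by (simp add: vec_eq_iff algebra_simps)
  qed
  also have "det ((s * ?n2) *\<^sub>R mat 1 + s *\<^sub>R norm_laplacian E1) = s ^ CARD('a) * ?n2 * ?P"
  proof -
    have "s \<noteq> 0" using r1 n2pos by (simp add: s_def)
    then have "det ((s * ?n2) *\<^sub>R mat 1 + s *\<^sub>R norm_laplacian E1) =
        s * ?n2 * (\<Prod>i=2..CARD('a). s * (?n2 + mu i))"
      by (simp add: det_shift_norm_laplacian[OF G1 reg1 r1 mu1 mu_eig] distrib_left)
    also have "\<dots> = s * s ^ (CARD('a) - 1) * ?n2 * ?P"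
      by (simp add: prod.distrib)
    finally show ?thesis by (simp add: power_eq_if)
  qed
  also have "det ?D = (2 + ?n2) ^ card E1" by (rule det_diag_on)
  \<comment> \<open>The eigenvalue 0 of G1 leaves a factor \<open>?n2\<close>, which joins the
    rank-one factor to form the second m1 + n2.\<close>
  finally have "?t * (?m1 + ?n2) * (?m1 + ?n2) =
      s ^ CARD('a) * (2 + ?n2) ^ card E1 * ?P * ?Q * (?m1 + ?n2) * (?n2 * (1 + ?m1 / ?n2))"
    by (simp only: mult_ac)
  also have "?n2 * (1 + ?m1 / ?n2) = ?m1 + ?n2"
    using n2pos by (simp add: distrib_left)
  finally have "?t * (?m1 + ?n2)\<^sup>2 = s ^ CARD('a) * (2 + ?n2) ^ card E1 * ?P * ?Q * (?m1 + ?n2)\<^sup>2"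
    by (simp only: power2_eq_square mult.assoc)
  moreover have "?m1 + ?n2 \<noteq> 0" using n2pos by linarith
  ultimately have "?t = s ^ CARD('a) * (2 + ?n2) ^ card E1 * ?P * ?Q" by simp
  \<comment> \<open>The denominators of the powers of \<open>s\<close> lower the exponent of 2 + n2
    by n1, possibly below 0.\<close>
  moreover have "s ^ CARD('a) * (2 + ?n2) ^ card E1 = real r1 ^ CARD('a) * (2 + ?n2) powi (int (card E1) - int CARD('a))"
    using n2pos by (simp add: s_def power_divide power_int_diff)
  ultimately show ?thesis by simp
qed

end

text \<open>Factoring the characteristic polynomials lists the eigenvalues with multiplicity, and a
  product from 2 to 1 is empty, which covers a single index.\<close>

theorem theorem3p4:
  fixes E1 :: "('a::finite) set set" and E2 :: "('b::finite) set set"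
    and r1 r2 :: nat and mu nu :: "nat \<Rightarrow> real"
  assumes G1: "simple_graph (UNIV :: 'a set) E1" and reg1: "regular UNIV E1 r1" and r1: "r1 \<ge> 1"
    and G2: "simple_graph (UNIV :: 'b set) E2" and reg2: "regular UNIV E2 r2" and r2: "r2 \<ge> 1"
    and mu1: "mu 1 = 0"
    and mu_eig: "\<forall>x::real. det (x *\<^sub>R mat 1 - norm_laplacian E1) = (\<Prod>i=1..CARD('a). x - mu i)"
    and nu1: "nu 1 = 0"
    and nu_eig: "\<forall>x::real. det (x *\<^sub>R mat 1 - norm_laplacian E2) = (\<Prod>j=1..CARD('b). x - nu j)"
  shows "real (num_spanning_trees (svjoin_V UNIV E1 UNIV) (svjoin_E UNIV E1 UNIV E2))
           = 2 powi (int (card E1) - int CARD('a) + 1)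
             * (\<Prod>i=2..CARD('a). 2 * real CARD('b) + real r1 * mu i)
             * (\<Prod>j=2..CARD('b). real CARD('a) + real r2 * nu j)
       \<and> real (num_spanning_trees (svjoin_V UNIV E1 UNIV) (sejoin_E E1 UNIV E2))
           = real r1 ^ CARD('a) * (2 + real CARD('b)) powi (int (card E1) - int CARD('a))
             * (\<Prod>i=2..CARD('a). real CARD('b) + mu i)
             * (\<Prod>j=2..CARD('b). real (card E1) + real r2 * nu j)"
  using num_spanning_trees_svjoin[OF assms] num_spanning_trees_sejoin[OF assms] by blast

end
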